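(* Let $k\ge 1$ and $m\ge 1$ be integers, and let $\mathcal{H}=(H_1,\ldots,H_m)$, where each $H_i$ is a finite nonempty $k$-uniform hypergraph. Let $H=\dot{\bigcup}_{i\in[m]}H_i$ be the multihypergraph that is the union of the $H_i$ counted with multiplicity. If $|H_i|\ge 2\Delta(L(H))$ for every $i\in[m]$, then $(H_1,\ldots,H_m)$ has a system of disjoint representatives (SJR).
   Context: $[m]=\{1,\ldots,m\}$. A hypergraph is identified with its set of edges (nonempty sets of vertices, all hypergraphs being on a common vertex set); it is $k$-uniform if every edge has exactly $k$ vertices; $|H_i|$ is the number of edges of $H_i$. In the multiset union $\dot{\bigcup}_{i\in[m]}H_i$, an edge belonging to several of the $H_i$ appears once for each such $i$. The line graph $L(H)$ of a multihypergraph $H$ is the graph whose vertices are the edges of $H$ (with multiplicity), two distinct vertices being adjacent if the corresponding hyperedges intersect (in particular, distinct copies of the same hyperedge are adjacent). $\Delta(G)$ denotes the maximum degree of a graph $G$. An SJR of $(H_1,\ldots,H_m)$ is a function $f:[m]\to\bigcup_{i\in[m]}H_i$ with $f(i)\in H_i$ for all $i$ and $f(i)\cap f(j)=\emptyset$ whenever $i\ne j$. *)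

theory Defs
  imports Main "HOL-Library.Multiset"
begin

type_synonym 'a hypergraph = "'a set set"

type_synonym 'a multihypergraph = "'a set multiset"

definition hypergraph :: "'a hypergraph \<Rightarrow> bool" where
  "hypergraph H \<longleftrightarrow> (\<forall>e\<in>H. e \<noteq> {})"

definition uniform :: "nat \<Rightarrow> 'a hypergraph \<Rightarrow> bool" where
  "uniform k H \<longleftrightarrow> (\<forall>e\<in>H. finite e \<and> card e = k)"

text \<open>The families are indexed by the numbers from 1 to m; values of H outside this range are
  irrelevant. Each H i is required to be finite wherever the following union is used
  (mset_set of an infinite set is the empty multiset).\<close>

definition multi_union :: "nat \<Rightarrow> (nat \<Rightarrow> 'a hypergraph) \<Rightarrow> 'a multihypergraph" where
  "multi_union m H = (\<Sum>i\<in>{1..m}. mset_set (H i))"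

text \<open>A simple graph is a pair of a vertex set and a set of two-element sets of vertices.\<close>

type_synonym 'v graph = "'v set \<times> 'v set set"

definition degree :: "'v graph \<Rightarrow> 'v \<Rightarrow> nat" where
  "degree G v = card {w \<in> fst G. {v, w} \<in> snd G}"

text \<open>Only meaningful for a finite graph with at least one vertex.\<close>

definition max_degree :: "'v graph \<Rightarrow> nat" where
  "max_degree G = Max (degree G ` fst G)"

text \<open>The copies of an edge e of multiplicity c are represented by (e, 0), ..., (e, c - 1).\<close>

definition edge_copies :: "'a multihypergraph \<Rightarrow> ('a set \<times> nat) set" where
  "edge_copies M = {(e, j). j < count M e}"

definition line_graph :: "'a multihypergraph \<Rightarrow> ('a set \<times> nat) graph" where
  "line_graph M =
    (edge_copies M,
     {{x, y} | x y. x \<in> edge_copies M \<and> y \<in> edge_copies M \<and> x \<noteq> y \<and> fst x \<inter> fst y \<noteq> {}})"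

definition is_SJR :: "nat \<Rightarrow> (nat \<Rightarrow> 'a hypergraph) \<Rightarrow> (nat \<Rightarrow> 'a set) \<Rightarrow> bool" where
  "is_SJR m H f \<longleftrightarrow>
    (\<forall>i\<in>{1..m}. f i \<in> H i) \<and>
    (\<forall>i\<in>{1..m}. \<forall>j\<in>{1..m}. i \<noteq> j \<longrightarrow> f i \<inter> f j = {})"

end

theory Submission
  imports Defs "HOL-Library.Disjoint_Sets"
begin

text \<open>
  This is Haxell's theorem on independent transversals, applied to the line graph with its vertices
  partitioned according to the \<open>H i\<close>. By induction there is an independent transversal \<open>t\<close> of all
  parts but one, say \<open>P a\<close>. Suppose it cannot be completed. One picks vertices
  \<open>v 0, v 1, \<dots>\<close> one after the other, each time replacing \<open>t\<close> by a transversal which keeps the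
  neighbourhoods of the earlier \<open>v l\<close> in \<open>t\<close> and has as few neighbours of the new vertex as
  possible. The new vertex is taken from \<open>P a\<close> or from a part meeting one of the earlier
  neighbourhoods, and is not dominated by the earlier \<open>v l\<close> and their neighbourhoods; the size
  condition guarantees that it exists. It has a neighbour in \<open>t\<close>, as otherwise
  swapping it into \<open>t\<close> would complete \<open>t\<close> or contradict an earlier minimal choice. Hence the
  neighbourhoods are nonempty and disjoint, and the process cannot go on forever.
\<close>

section \<open>Independent transversals and greedy sequences\<close>

definition indep_transversal ::
    "('v \<Rightarrow> 'v \<Rightarrow> bool) \<Rightarrow> ('i \<Rightarrow> 'v set) \<Rightarrow> 'i set \<Rightarrow> ('i \<Rightarrow> 'v) \<Rightarrow> bool" where
  "indep_transversal adj P I t \<longleftrightarrow>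
    (\<forall>i\<in>I. t i \<in> P i) \<and> (\<forall>i\<in>I. \<forall>j\<in>I. i \<noteq> j \<longrightarrow> \<not> adj (t i) (t j))"

definition nbrs_in :: "('v \<Rightarrow> 'v \<Rightarrow> bool) \<Rightarrow> 'v set \<Rightarrow> 'v \<Rightarrow> 'v set" where
  "nbrs_in adj T x = {y \<in> T. adj x y}"

text \<open>Minimality at every \<open>v l\<close> is stated for the one current \<open>t\<close>,
  not for the transversal at the time of choice: later replacements keep the earlier neighbourhoods,
  so it is inherited.\<close>

definition greedy_sequence ::
    "('v \<Rightarrow> 'v \<Rightarrow> bool) \<Rightarrow> ('i \<Rightarrow> 'v set) \<Rightarrow> 'i set \<Rightarrow> 'v set \<Rightarrow> nat \<Rightarrow> (nat \<Rightarrow> 'v) \<Rightarrow> ('i \<Rightarrow> 'v) \<Rightarrow> bool"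
  where
  "greedy_sequence adj P I V n v t \<longleftrightarrow>
    indep_transversal adj P I t \<and>
    (\<forall>l<n. v l \<in> V \<and> nbrs_in adj (t ` I) (v l) \<noteq> {}) \<and>
    (\<forall>l<n. \<forall>l'<l. nbrs_in adj (t ` I) (v l) \<inter> nbrs_in adj (t ` I) (v l') = {}) \<and>
    (\<forall>l<n. \<forall>t'. indep_transversal adj P I t' \<longrightarrow>
      (\<forall>l'<l. nbrs_in adj (t' ` I) (v l') = nbrs_in adj (t ` I) (v l')) \<longrightarrow>
      card (nbrs_in adj (t ` I) (v l)) \<le> card (nbrs_in adj (t' ` I) (v l)))"

text \<open>For \<open>i\<close> outside \<open>I\<close> this extends \<open>t\<close>; for
  \<open>i\<close> in \<open>I\<close> it is a swap, as then \<open>insert i I = I\<close>.\<close>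

lemma indep_transversal_update:
  assumes t: "indep_transversal adj P I t" and x: "x \<in> P i"
    and sym: "\<And>x y. adj x y \<Longrightarrow> adj y x"
    and no: "nbrs_in adj (t ` I) x = {}"
  shows "indep_transversal adj P (insert i I) (t(i := x))"
proof -
  have "\<not> adj x (t j)" "\<not> adj (t j) x" if "j \<in> I" for j
    using no that sym[of "t j" x] by (auto simp: nbrs_in_def)
  then show ?thesis
    using t x unfolding indep_transversal_def by simp
qed

lemma card_dominated_le:
  assumes fin: "finite V" "finite U" "U \<subseteq> V"
    and deg: "\<And>x. x \<in> V \<Longrightarrow> card {y \<in> V. adj x y} \<le> d"
  shows "card {y \<in> V. \<exists>x\<in>U. adj x y} \<le> d * card U"
proof -
  have "{y \<in> V. \<exists>x\<in>U. adj x y} = (\<Union>x\<in>U. {y \<in> V. adj x y})" by auto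
  also have "card \<dots> \<le> (\<Sum>x\<in>U. card {y \<in> V. adj x y})"
    by (rule card_UN_le[OF fin(2)])
  also have "\<dots> \<le> (\<Sum>x\<in>U. d)" using deg fin(3) by (intro sum_mono) auto
  finally show ?thesis by (simp add: mult.commute)
qed

lemma greedy_sequence_length_le:
  assumes "greedy_sequence adj P I V n v t" and I: "finite I"
  shows "n \<le> card (\<Union>l<n. nbrs_in adj (t ` I) (v l))"
proof -
  let ?N = "\<lambda>l. nbrs_in adj (t ` I) (v l)"
  have fin: "finite (?N l)" for l using I by (auto simp: nbrs_in_def)
  have disj: "?N l \<inter> ?N l' = {}" if "l < n" "l' < n" "l \<noteq> l'" for l l'
    using assms(1) that unfolding greedy_sequence_def by (metis inf_commute linorder_neqE_nat)
  have "card (\<Union>l<n. ?N l) = (\<Sum>l<n. card (?N l))"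
    using fin disj by (intro card_UN_disjoint) auto
  moreover have "(\<Sum>l<n. 1) \<le> (\<Sum>l<n. card (?N l))"
    using assms(1) fin by (intro sum_mono) (auto simp: greedy_sequence_def Suc_le_eq card_gt_0_iff)
  ultimately show ?thesis by simp
qed

text \<open>Counting: \<open>U\<close> has at least \<open>n\<close> elements, so the
  \<open>v l\<close> and \<open>U\<close> together dominate at most \<open>2 * d * card U\<close>
  vertices. The parts represented in \<open>U\<close> already hold that many, and the nonempty part
  \<open>P a\<close> makes the inequality strict.\<close>

lemma ex_undominated:
  assumes I: "finite I" "a \<notin> I"
    and disj: "disjoint_family_on P (insert a I)"
    and fin: "\<And>i. i \<in> insert a I \<Longrightarrow> finite (P i)"
    and size: "\<And>i. i \<in> I \<Longrightarrow> 2 * d \<le> card (P i)" and ne: "P a \<noteq> {}"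
    and V: "V = (\<Union>i\<in>insert a I. P i)"
    and deg: "\<And>x. x \<in> V \<Longrightarrow> card {y \<in> V. adj x y} \<le> d"
    and seq: "greedy_sequence adj P I V n v t"
    and U: "U = (\<Union>l<n. nbrs_in adj (t ` I) (v l))"
  obtains i x where "i \<in> insert a I" "x \<in> P i" "i = a \<or> t i \<in> U"
    "\<And>u. u \<in> v ` {..<n} \<union> U \<Longrightarrow> \<not> adj u x"
proof -
  let ?D = "{y \<in> V. \<exists>x\<in>v ` {..<n} \<union> U. adj x y}"
  let ?S = "{i \<in> I. t i \<in> U}"
  have tP: "t i \<in> P i" if "i \<in> I" for i
    using seq that by (auto simp: greedy_sequence_def indep_transversal_def)
  have UI: "U \<subseteq> t ` I" by (auto simp: U nbrs_in_def)
  then have UV: "U \<subseteq> V" using tP by (auto simp: V)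
  have finV: "finite V" using I fin by (auto simp: V)
  have finU: "finite U" using finite_subset[OF UV finV] .
  have vV: "v ` {..<n} \<subseteq> V" using seq by (auto simp: greedy_sequence_def)
  have "n \<le> card U" using greedy_sequence_length_le[OF seq I(1)] by (simp add: U)
  have "card U \<le> card ?S"
  proof -
    have "U \<subseteq> t ` ?S" using UI by auto
    then show ?thesis using I(1) by (intro surj_card_le[of ?S U t]) auto
  qed
  have "card (v ` {..<n} \<union> U) \<le> card (v ` {..<n}) + card U" by (rule card_Un_le)
  also have "\<dots> \<le> n + card U" using card_image_le[of "{..<n}" v] by simp
  also have "\<dots> \<le> 2 * card ?S" using \<open>n \<le> card U\<close> \<open>card U \<le> card ?S\<close> by simp
  finally have c: "card (v ` {..<n} \<union> U) \<le> 2 * card ?S" .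
  have "card ?D \<le> d * card (v ` {..<n} \<union> U)"
    using finV finU UV vV deg by (intro card_dominated_le) auto
  also have "\<dots> \<le> (\<Sum>i\<in>?S. 2 * d)" using mult_le_mono2[OF c, of d] by (simp add: mult_ac)
  also have "\<dots> \<le> (\<Sum>i\<in>?S. card (P i))" using size by (intro sum_mono) auto
  also have "\<dots> < card (P a) + (\<Sum>i\<in>?S. card (P i))"
    using ne fin by (simp add: card_gt_0_iff)
  also have "\<dots> = (\<Sum>i\<in>insert a ?S. card (P i))" using I by simp
  also have "\<dots> = card (\<Union>i\<in>insert a ?S. P i)"
    using I fin disj by (intro card_UN_disjoint[symmetric]) (auto simp: disjoint_family_on_def)
  finally have "\<not> (\<Union>i\<in>insert a ?S. P i) \<subseteq> ?D"
    using card_mono[of ?D "\<Union>i\<in>insert a ?S. P i"] finV by (auto simp: not_le)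
  then obtain x where "x \<in> (\<Union>i\<in>insert a ?S. P i)" and D: "x \<notin> ?D" unfolding subset_iff by blast
  then obtain i where "i \<in> insert a ?S" "x \<in> P i" by blast
  then show ?thesis using that[of i x] D by (auto simp: V)
qed

lemma greedy_sequence_extend:
  assumes I: "finite I" "a \<notin> I"
    and disj: "disjoint_family_on P (insert a I)"
    and fin: "\<And>i. i \<in> insert a I \<Longrightarrow> finite (P i)"
    and size: "\<And>i. i \<in> I \<Longrightarrow> 2 * d \<le> card (P i)" and ne: "P a \<noteq> {}"
    and sym: "\<And>x y. adj x y \<Longrightarrow> adj y x"
    and V: "V = (\<Union>i\<in>insert a I. P i)"
    and deg: "\<And>x. x \<in> V \<Longrightarrow> card {y \<in> V. adj x y} \<le> d"
    and noIT: "\<nexists>t. indep_transversal adj P (insert a I) t"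
    and seq: "greedy_sequence adj P I V n v t"
  shows "\<exists>v' t'. greedy_sequence adj P I V (Suc n) v' t'"
proof -
  let ?N = "\<lambda>t. nbrs_in adj (t ` I)"
  define U where "U = (\<Union>l<n. ?N t (v l))"
  obtain i x where ix: "i \<in> insert a I" "x \<in> P i" "i = a \<or> t i \<in> U"
    and undom: "\<And>u. u \<in> v ` {..<n} \<union> U \<Longrightarrow> \<not> adj u x"
    using ex_undominated[OF I disj fin size ne V deg seq U_def] by blast
  \<comment> \<open>These are exactly the competitors in the minimality condition for the new index
    \<open>n\<close>.\<close>
  define feasible where
    "feasible t' \<longleftrightarrow> indep_transversal adj P I t' \<and> (\<forall>l<n. ?N t' (v l) = ?N t (v l))" for t'
  have "feasible t" using seq by (simp add: feasible_def greedy_sequence_def)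
  then obtain t' where feas: "feasible t'"
    and min: "\<And>s. feasible s \<Longrightarrow> card (?N t' x) \<le> card (?N s x)"
    using ex_has_least_nat[of feasible t "\<lambda>s. card (?N s x)"] by blast
  have t': "indep_transversal adj P I t'" and N': "\<And>l. l < n \<Longrightarrow> ?N t' (v l) = ?N t (v l)"
    using feas by (auto simp: feasible_def)
  \<comment> \<open>Otherwise \<open>x\<close> can be put into \<open>t'\<close>. If
    \<open>i = a\<close>, this contradicts \<open>noIT\<close>; if not, the swap shrinks the
    neighbourhood of some \<open>v l\<close> containing \<open>t i\<close>, against the minimality
    at \<open>l\<close>.\<close>
  have nonempty: "?N t' x \<noteq> {}"
  proof
    assume empty: "?N t' x = {}"
    note upd = indep_transversal_update[OF t' ix(2) sym empty]
    with noIT have "i \<noteq> a" by auto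
    with ix have iI: "i \<in> I" "t i \<in> U" by auto
    then obtain l where l: "l < n" "t i \<in> ?N t (v l)" by (auto simp: U_def)
    have inP: "j \<in> I \<Longrightarrow> t j \<in> P j" "j \<in> I \<Longrightarrow> t' j \<in> P j" for j
      using t' seq by (auto simp: indep_transversal_def greedy_sequence_def)
    have sameP: "j = j'" if "j \<in> I" "j' \<in> I" "y \<in> P j" "y \<in> P j'" for j j' y
      using disj that unfolding disjoint_family_on_def by blast
    \<comment> \<open>\<open>t'\<close> keeps the neighbourhood containing \<open>t i\<close>, and
      disjointness of the parts then forces \<open>t' i = t i\<close>. So the swap removes precisely
      \<open>t i\<close>.\<close>
    from l N' have "t i \<in> t' ` I" by (auto simp: nbrs_in_def)
    then obtain j where j: "j \<in> I" "t' j = t i" by auto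
    then have "j = i" using inP[of i] inP(2)[of j] iI(1) by (intro sameP[of j i "t i"]) auto
    with j have eq: "t' i = t i" by simp
    let ?s = "t'(i := x)"
    have img: "?s ` I = insert x (t' ` I - {t i})"
    proof -
      have "t' j = t i \<longleftrightarrow> j = i" if "j \<in> I" for j
        using that iI(1) eq inP(2)[of i] inP(2)[of j] sameP[of j i "t' i"] by auto
      then have "t' ` (I - {i}) = t' ` I - {t i}" by auto
      then show ?thesis using iI(1) by (auto simp: image_def)
    qed
    \<comment> \<open>The incoming \<open>x\<close> adds nothing, since no \<open>v l'\<close>
      dominates it.\<close>
    have Ns: "?N ?s (v l') = ?N t (v l') - {t i}" if "l' < n" for l'
      using undom[of "v l'"] that
      unfolding N'[OF that, symmetric] unfolding nbrs_in_def img by auto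
    \<comment> \<open>Neighbourhoods before \<open>l\<close> miss \<open>t i\<close> by
      disjointness, so \<open>?s\<close> competes with \<open>t\<close> at \<open>l\<close>.\<close>
    have "?N ?s (v l') = ?N t (v l')" if "l' < l" for l'
    proof -
      have "?N t (v l) \<inter> ?N t (v l') = {}"
        using seq l that by (auto simp: greedy_sequence_def)
      then show ?thesis using Ns[of l'] l that by auto
    qed
    moreover have "indep_transversal adj P I ?s" using upd iI by (simp add: insert_absorb)
    ultimately have "card (?N t (v l)) \<le> card (?N ?s (v l))"
      using seq l(1) unfolding greedy_sequence_def by blast
    moreover have "finite (?N t (v l))" using I by (simp add: nbrs_in_def)
    then have "card (?N ?s (v l)) < card (?N t (v l))"
      unfolding Ns[OF l(1)] using l(2) by (rule card_Diff1_less)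
    ultimately show False by simp
  qed
  \<comment> \<open>This is why \<open>x\<close> must be undominated by \<open>U\<close> as well as
    by the \<open>v l\<close>.\<close>
  have Ux: "?N t' x \<inter> ?N t (v l) = {}" if "l < n" for l
    using undom sym that by (force simp: U_def nbrs_in_def)
  have "greedy_sequence adj P I V (Suc n) (v(n := x)) t'"
    unfolding greedy_sequence_def
  proof (intro conjI allI impI)
    fix l assume "l < Suc n"
    then show "(v(n := x)) l \<in> V" "?N t' ((v(n := x)) l) \<noteq> {}"
      using seq ix nonempty N'[of l] by (auto simp: greedy_sequence_def V less_Suc_eq)
  next
    fix l l' assume "l < Suc n" "l' < l"
    then show "?N t' ((v(n := x)) l) \<inter> ?N t' ((v(n := x)) l') = {}"
      using seq Ux[of l'] N'[of l] N'[of l']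
      by (cases "l = n") (auto simp: greedy_sequence_def)
  next
    fix l s
    assume l: "l < Suc n" and s: "indep_transversal adj P I s"
      and eq: "\<forall>l'<l. ?N s ((v(n := x)) l') = ?N t' ((v(n := x)) l')"
    have eq': "?N s (v l') = ?N t (v l')" if "l' < l" for l'
      using eq[rule_format, OF that] N'[of l'] that l by auto
    \<comment> \<open>For \<open>l = n\<close> the agreement makes \<open>s\<close> feasible; for
      smaller \<open>l\<close> the old minimality of \<open>t\<close> carries over, as
      \<open>t'\<close> and \<open>t\<close> give \<open>v l\<close> the same neighbours.\<close>
    show "card (?N t' ((v(n := x)) l)) \<le> card (?N s ((v(n := x)) l))"
    proof (cases "l = n")
      case True
      then show ?thesis using min[of s] s eq' by (simp add: feasible_def)
    next
      case False
      then show ?thesis using seq s eq' l N'[of l] by (simp add: greedy_sequence_def)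
    qed
  qed (fact t')
  then show ?thesis by blast
qed

text \<open>Without a full transversal, greedy sequences of every length exist; one of length
  \<open>card I + 1\<close> needs more disjoint nonempty neighbourhoods than \<open>t\<close> has
  values on \<open>I\<close>.\<close>

lemma indep_transversal_insert:
  assumes I: "finite I" "a \<notin> I"
    and disj: "disjoint_family_on P (insert a I)"
    and fin: "\<And>i. i \<in> insert a I \<Longrightarrow> finite (P i)"
    and size: "\<And>i. i \<in> I \<Longrightarrow> 2 * d \<le> card (P i)" and ne: "P a \<noteq> {}"
    and sym: "\<And>x y. adj x y \<Longrightarrow> adj y x"
    and deg: "\<And>x. x \<in> (\<Union>i\<in>insert a I. P i) \<Longrightarrow>
      card {y \<in> (\<Union>i\<in>insert a I. P i). adj x y} \<le> d"
    and t: "indep_transversal adj P I t"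
  shows "\<exists>t. indep_transversal adj P (insert a I) t"
proof (rule ccontr)
  assume noIT: "\<nexists>t. indep_transversal adj P (insert a I) t"
  define V where "V = (\<Union>i\<in>insert a I. P i)"
  have "\<exists>v t. greedy_sequence adj P I V n v t" for n
  proof (induction n)
    case 0
    then show ?case using t by (auto simp: greedy_sequence_def)
  next
    case (Suc n)
    then show ?case
      using greedy_sequence_extend[OF I disj fin size ne sym V_def deg[folded V_def] noIT] by blast
  qed
  then obtain v t where seq: "greedy_sequence adj P I V (Suc (card I)) v t" by blast
  have "Suc (card I) \<le> card (\<Union>l<Suc (card I). nbrs_in adj (t ` I) (v l))"
    by (rule greedy_sequence_length_le[OF seq I(1)])
  also have "\<dots> \<le> card (t ` I)"
    using I by (intro card_mono) (auto simp: nbrs_in_def)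
  also have "\<dots> \<le> card I" using I by (simp add: card_image_le)
  finally show False by simp
qed

section \<open>Haxell's theorem, by induction on the set of parts\<close>

theorem haxell:
  assumes "finite I" and "disjoint_family_on P I"
    and "\<And>i. i \<in> I \<Longrightarrow> finite (P i)"
    and "\<And>i. i \<in> I \<Longrightarrow> P i \<noteq> {}"
    and "\<And>i. i \<in> I \<Longrightarrow> 2 * d \<le> card (P i)"
    and sym: "\<And>x y. adj x y \<Longrightarrow> adj y x"
    and "\<And>x. x \<in> (\<Union>i\<in>I. P i) \<Longrightarrow> card {y \<in> (\<Union>i\<in>I. P i). adj x y} \<le> d"
  shows "\<exists>t. indep_transversal adj P I t"
  using assms(1-5) assms(7)
proof (induction I rule: finite_induct)
  case empty
  show ?case by (simp add: indep_transversal_def)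
next
  case (insert a I)
  have "card {y \<in> (\<Union>i\<in>I. P i). adj x y} \<le> d" if "x \<in> (\<Union>i\<in>I. P i)" for x
  proof -
    have "card {y \<in> (\<Union>i\<in>I. P i). adj x y} \<le> card {y \<in> (\<Union>i\<in>insert a I. P i). adj x y}"
      using insert.hyps insert.prems(2) by (intro card_mono) auto
    also have "\<dots> \<le> d" using insert.prems(5)[of x] that by blast
    finally show ?thesis .
  qed
  moreover have "disjoint_family_on P I"
    using insert.prems(1) by (auto simp: disjoint_family_on_def)
  ultimately obtain t where "indep_transversal adj P I t"
    using insert.IH insert.prems(2,3,4) by blast
  then show ?case
    using insert.hyps insert.prems sym
    by (intro indep_transversal_insert[where t = t and d = d]) auto
qed

section \<open>Degrees in the line graph of the multiset union\<close>

lemma count_multi_union: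
  assumes "\<forall>i\<in>{1..m}. finite (H i)"
  shows "count (multi_union m H) e = card {i \<in> {1..m}. e \<in> H i}"
proof -
  have "count (multi_union m H) e = (\<Sum>i\<in>{1..m}. count (mset_set (H i)) e)"
    by (simp add: multi_union_def count_sum)
  also have "\<dots> = (\<Sum>i\<in>{1..m}. if e \<in> H i then 1 else 0)"
    using assms by (intro sum.cong) (auto simp: count_mset_set')
  also have "\<dots> = card {i \<in> {1..m}. e \<in> H i}"
    by (simp add: sum.If_cases Int_def)
  finally show ?thesis .
qed

lemma in_multi_union_iff:
  assumes "\<forall>i\<in>{1..m}. finite (H i)"
  shows "e \<in># multi_union m H \<longleftrightarrow> (\<exists>i\<in>{1..m}. e \<in> H i)"
proof -
  have "e \<in># multi_union m H \<longleftrightarrow> 0 < card {i \<in> {1..m}. e \<in> H i}"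
    by (simp only: count_multi_union[OF assms, symmetric] count_greater_zero_iff)
  then show ?thesis by (auto simp: card_gt_0_iff)
qed

lemma edge_copies_eq_Sigma: "edge_copies M = (SIGMA e:set_mset M. {..<count M e})"
  by (auto simp: edge_copies_def simp flip: count_greater_zero_iff)

lemma finite_edge_copies: "finite (edge_copies M)"
  by (simp add: edge_copies_eq_Sigma)

text \<open>Both sides count each edge \<open>e\<close> once per family containing it. This moves
  degree counts from the anonymous copies \<open>(e, j)\<close> to pairs \<open>(i, e)\<close>,
  which remember their family.\<close>

lemma card_edge_copies_Collect:
  assumes "\<forall>i\<in>{1..m}. finite (H i)"
  shows "card {w \<in> edge_copies (multi_union m H). Q (fst w)} =
    card {w \<in> (SIGMA i:{1..m}. H i). Q (snd w)}"
proof -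
  let ?M = "multi_union m H" and ?E = "{e \<in> set_mset (multi_union m H). Q e}"
  have "{w \<in> edge_copies ?M. Q (fst w)} = (SIGMA e:?E. {..<count ?M e})"
    by (auto simp: edge_copies_eq_Sigma)
  then have "card {w \<in> edge_copies ?M. Q (fst w)} = (\<Sum>e\<in>?E. count ?M e)"
    by (simp add: card_SigmaI)
  also have "\<dots> = (\<Sum>e\<in>?E. card {i \<in> {1..m}. e \<in> H i})"
    by (simp only: count_multi_union[OF assms])
  also have "\<dots> = card (SIGMA e:?E. {i \<in> {1..m}. e \<in> H i})"
    by (simp add: card_SigmaI)
  also have "\<dots> = card (prod.swap ` (SIGMA e:?E. {i \<in> {1..m}. e \<in> H i}))"
    by (simp add: card_image)
  also have "prod.swap ` (SIGMA e:?E. {i \<in> {1..m}. e \<in> H i}) =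
      {w \<in> (SIGMA i:{1..m}. H i). Q (snd w)}"
    by (auto simp: image_iff Bex_def in_multi_union_iff[OF assms])
  finally show ?thesis .
qed

lemma fst_line_graph: "fst (line_graph M) = edge_copies M"
  by (simp add: line_graph_def)

lemma degree_line_graph:
  assumes "x \<in> edge_copies M"
  shows "degree (line_graph M) x =
    card ({w \<in> edge_copies M. fst x \<inter> fst w \<noteq> {}} - {x})"
proof -
  have *: "{x, w} \<in> snd (line_graph M) \<longleftrightarrow> x \<noteq> w \<and> fst x \<inter> fst w \<noteq> {}"
    if "w \<in> edge_copies M" for w
    using assms that unfolding line_graph_def snd_conv mem_Collect_eq doubleton_eq_iff by blast
  have "{w \<in> fst (line_graph M). {x, w} \<in> snd (line_graph M)} =
      {w \<in> edge_copies M. fst x \<inter> fst w \<noteq> {}} - {x}"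
    by (intro set_eqI) (use * in \<open>auto simp: fst_line_graph\<close>)
  then show ?thesis by (simp add: degree_def)
qed

lemma degree_le_max_degree:
  assumes "finite (fst G)" "x \<in> fst G"
  shows "degree G x \<le> max_degree G"
  using assms by (simp add: max_degree_def)

lemma card_intersecting_le_max_degree:
  assumes fin: "\<forall>i\<in>{1..m}. finite (H i)"
    and p: "p \<in> (SIGMA i:{1..m}. H i)" and ne: "snd p \<noteq> {}"
  shows "card ({w \<in> (SIGMA i:{1..m}. H i). snd p \<inter> snd w \<noteq> {}} - {p})
    \<le> max_degree (line_graph (multi_union m H))"
proof -
  let ?M = "multi_union m H" and ?e = "snd p"
  have "?e \<in># ?M"
    using p by (auto simp: in_multi_union_iff[OF fin])
  \<comment> \<open>Copy \<open>0\<close> stands in for \<open>p\<close>. A nonempty edge meets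
    itself, so removing the vertex itself lowers both counts by exactly one.\<close>
  then have x: "(?e, 0) \<in> edge_copies ?M" by (simp add: edge_copies_def count_greater_zero_iff)
  have "card ({w \<in> (SIGMA i:{1..m}. H i). ?e \<inter> snd w \<noteq> {}} - {p}) =
      card {w \<in> (SIGMA i:{1..m}. H i). ?e \<inter> snd w \<noteq> {}} - 1"
    using p ne by (intro card_Diff_singleton) auto
  also have "\<dots> = card {w \<in> edge_copies ?M. ?e \<inter> fst w \<noteq> {}} - 1"
    using card_edge_copies_Collect[OF fin, where Q = "\<lambda>f. ?e \<inter> f \<noteq> {}"] by simp
  also have "\<dots> = card ({w \<in> edge_copies ?M. ?e \<inter> fst w \<noteq> {}} - {(?e, 0)})"
    using x ne by (intro card_Diff_singleton[symmetric]) auto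
  also have "\<dots> = degree (line_graph ?M) (?e, 0)"
    using degree_line_graph[OF x] by simp
  also have "\<dots> \<le> max_degree (line_graph ?M)"
    using x by (intro degree_le_max_degree) (auto simp: fst_line_graph finite_edge_copies)
  finally show ?thesis .
qed

section \<open>From independent transversals to disjoint representatives\<close>

theorem theorem5p1:
  fixes k m :: nat and H :: "nat \<Rightarrow> 'a hypergraph"
  assumes "k \<ge> 1" and "m \<ge> 1"
    and "\<And>i. i \<in> {1..m} \<Longrightarrow> hypergraph (H i)"
    and "\<And>i. i \<in> {1..m} \<Longrightarrow> finite (H i)"
    and "\<And>i. i \<in> {1..m} \<Longrightarrow> H i \<noteq> {}"
    and "\<And>i. i \<in> {1..m} \<Longrightarrow> uniform k (H i)"
    and "\<And>i. i \<in> {1..m} \<Longrightarrow> card (H i) \<ge> 2 * max_degree (line_graph (multi_union m H))"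
  shows "\<exists>f. is_SJR m H f"
proof -
  \<comment> \<open>Comparing whole pairs excludes loops but keeps equal edges of different families
    adjacent, as in the line graph.\<close>
  define adj :: "nat \<times> 'a set \<Rightarrow> nat \<times> 'a set \<Rightarrow> bool"
    where "adj p q \<longleftrightarrow> p \<noteq> q \<and> snd p \<inter> snd q \<noteq> {}" for p q
  \<comment> \<open>The tag \<open>i\<close> makes the parts disjoint even when the
    \<open>H i\<close> share edges.\<close>
  define P where "P i = {i} \<times> H i" for i
  have V: "(\<Union>i\<in>{1..m}. P i) = (SIGMA i:{1..m}. H i)" by (auto simp: P_def)
  have "\<exists>t. indep_transversal adj P {1..m} t"
  proof (rule haxell)
    fix p assume "p \<in> (\<Union>i\<in>{1..m}. P i)"
    then have p: "p \<in> (SIGMA i:{1..m}. H i)" by (simp only: V)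
    then have "snd p \<noteq> {}" using assms(3) by (auto simp: hypergraph_def)
    have "{q \<in> (\<Union>i\<in>{1..m}. P i). adj p q} =
        {w \<in> (SIGMA i:{1..m}. H i). snd p \<inter> snd w \<noteq> {}} - {p}"
      unfolding V by (auto simp: adj_def)
    then show "card {q \<in> (\<Union>i\<in>{1..m}. P i). adj p q}
        \<le> max_degree (line_graph (multi_union m H))"
      using card_intersecting_le_max_degree[OF _ p \<open>snd p \<noteq> {}\<close>] assms(4) by simp
  qed (use assms in \<open>auto simp: P_def adj_def disjoint_family_on_def card_cartesian_product\<close>)
  then obtain t where t: "indep_transversal adj P {1..m} t" by blast
  have "is_SJR m H (\<lambda>i. snd (t i))"
    unfolding is_SJR_def
  proof (intro conjI ballI impI)
    fix i assume i: "i \<in> {1..m}"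
    then show "snd (t i) \<in> H i"
      using t unfolding indep_transversal_def P_def by fastforce
    fix j assume j: "j \<in> {1..m}" and "i \<noteq> j"
    have "t i \<in> P i" "t j \<in> P j" "\<not> adj (t i) (t j)"
      using t i j \<open>i \<noteq> j\<close> by (auto simp: indep_transversal_def)
    \<comment> \<open>The tags differ, so \<open>t i\<close> and \<open>t j\<close> are distinct and
      non-adjacency can only mean disjoint edges.\<close>
    then show "snd (t i) \<inter> snd (t j) = {}"
      using \<open>i \<noteq> j\<close> by (auto simp: adj_def P_def)
  qed
  then show ?thesis by blast
qed

end
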